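(* Let $n\ge 2$ and $Q_{4n}=\langle x,y: x^n=y^2,\ x^{2n}=e,\ y^{-1}xy=x^{-1}\rangle$, and let $H$ be a proper subgroup of $Q_{4n}$. Then $H$ is a perfect code of $Q_{4n}$ if and only if one of the following holds: (a) $H=\langle x^t\rangle$ where $t$ is a positive integer dividing $2n$ with $2n/t$ odd; (b) $H=\langle x^t, x^s y\rangle$ where $t\ge 3$ is an odd integer dividing $2n$ and $s$ is an integer with $0\le s\le t-1$. Moreover, in case (a), $\langle x^t\rangle$ is a perfect code of $\mathrm{Cay}(Q_{4n},S)$ with $S=\{x^n, x^i, x^{-i}: 1\le i\le t/2-1\}\cup\{x^i y, x^{n+i}y: 0\le i\le t/2-1\}$; and in case (b), $\langle x^t,x^s y\rangle$ is a perfect code of $\mathrm{Cay}(Q_{4n},S)$ with $S=\{x^i,x^{-i}: 1\le i\le (t-1)/2\}$.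
   Context: $Q_{4n}$ is the generalized quaternion group of order $4n$. For a group $G$ and an inverse-closed subset $S\subseteq G$ with $e\notin S$, the Cayley graph $\mathrm{Cay}(G,S)$ has vertex set $G$, with distinct $u,v$ adjacent iff $vu^{-1}\in S$. A subset $C$ of the vertex set of a graph is a perfect code if it is independent and every vertex outside $C$ is adjacent to exactly one vertex of $C$. A subset $C$ of $G$ is a perfect code of $G$ if some Cayley graph $\mathrm{Cay}(G,S)$ admits $C$ as a perfect code. *)

theory Defs
  imports "HOL-Algebra.Algebra" "Graph_Theory.Pair_Digraph"
begin

section \<open>Groups given by generators and relations\<close>

text \<open>
  A word over a type of generators is a list of letters; the letter \<open>(g, True)\<close> stands for the
  generator \<open>g\<close> and \<open>(g, False)\<close> for its formal inverse.  A relation \<open>u = v\<close> is the pair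
  \<open>(u, v)\<close> of words.
\<close>

type_synonym 'g word = "('g \<times> bool) list"

inductive pres_eq :: "('g word \<times> 'g word) set \<Rightarrow> 'g word \<Rightarrow> 'g word \<Rightarrow> bool"
  for R :: "('g word \<times> 'g word) set" where
  refl: "pres_eq R u u"
| sym: "pres_eq R u v \<Longrightarrow> pres_eq R v u"
| trans: "pres_eq R u v \<Longrightarrow> pres_eq R v w \<Longrightarrow> pres_eq R u w"
| append: "pres_eq R u u' \<Longrightarrow> pres_eq R v v' \<Longrightarrow> pres_eq R (u @ v) (u' @ v')"
| cancel: "pres_eq R [(g, b), (g, \<not> b)] []"
| relation: "(u, v) \<in> R \<Longrightarrow> pres_eq R u v"

definition pres_rel :: "('g word \<times> 'g word) set \<Rightarrow> 'g word rel" where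
  "pres_rel R = {(u, v). pres_eq R u v}"

definition pres_class :: "('g word \<times> 'g word) set \<Rightarrow> 'g word \<Rightarrow> 'g word set" where
  "pres_class R w = pres_rel R `` {w}"

definition presented_group :: "('g word \<times> 'g word) set \<Rightarrow> 'g word set monoid" where
  "presented_group R =
     \<lparr>carrier = UNIV // pres_rel R,
      monoid.mult = (\<lambda>A B. \<Union>u\<in>A. \<Union>v\<in>B. pres_class R (u @ v)),
      monoid.one = pres_class R []\<rparr>"

lemma equiv_pres_rel: "equiv UNIV (pres_rel R)"
proof (rule equivI)
  show "pres_rel R \<subseteq> UNIV \<times> UNIV" by simp
  show "refl (pres_rel R)" by (simp add: pres_rel_def refl_on_def pres_eq.refl)
  show "sym (pres_rel R)" unfolding sym_def pres_rel_def by (blast intro: pres_eq.sym)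
  show "trans (pres_rel R)" unfolding trans_def pres_rel_def by (blast intro: pres_eq.trans)
qed

lemma pres_class_eq_iff: "pres_class R u = pres_class R v \<longleftrightarrow> pres_eq R u v"
  using eq_equiv_class_iff[OF equiv_pres_rel, of u v R]
  by (simp add: pres_class_def pres_rel_def)

lemma pres_class_self: "u \<in> pres_class R u"
  by (simp add: pres_class_def pres_rel_def pres_eq.refl)

lemma carrier_presented_group: "carrier (presented_group R) = range (pres_class R)"
  by (auto simp: presented_group_def quotient_def pres_class_def)

lemma one_presented_group: "\<one>\<^bsub>presented_group R\<^esub> = pres_class R []"
  by (simp add: presented_group_def)

lemma mult_presented_group:
  "pres_class R u \<otimes>\<^bsub>presented_group R\<^esub> pres_class R v = pres_class R (u @ v)"
proof -
  have "pres_class R (u' @ v') = pres_class R (u @ v)"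
    if "u' \<in> pres_class R u" "v' \<in> pres_class R v" for u' v'
  proof -
    have "pres_eq R u u'" "pres_eq R v v'"
      using that by (simp_all add: pres_class_def pres_rel_def)
    then show ?thesis
      unfolding pres_class_eq_iff by (intro pres_eq.sym[OF pres_eq.append])
  qed
  then have "(\<Union>u'\<in>pres_class R u. \<Union>v'\<in>pres_class R v. pres_class R (u' @ v')) =
      (\<Union>u'\<in>pres_class R u. \<Union>v'\<in>pres_class R v. pres_class R (u @ v))"
    by (intro SUP_cong HOL.refl)
  also have "\<dots> = pres_class R (u @ v)"
    using pres_class_self[of u R] pres_class_self[of v R] by blast
  finally show ?thesis
    by (simp only: presented_group_def monoid.simps)
qed

lemma pres_eq_left_inverse: "\<exists>u. pres_eq R (u @ w) []"
proof (induction w)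
  case Nil
  show ?case by (rule exI[of _ "[]"]) (simp add: pres_eq.refl)
next
  case (Cons a w)
  then obtain u where u: "pres_eq R (u @ w) []" by blast
  obtain g b where a: "a = (g, b)" by force
  have "pres_eq R [(g, \<not> b), (g, b)] []"
    using pres_eq.cancel[of R g "\<not> b"] by simp
  then have "pres_eq R ((u @ [(g, \<not> b), (g, b)]) @ w) ((u @ []) @ w)"
    by (intro pres_eq.append pres_eq.refl)
  then have "pres_eq R ((u @ [(g, \<not> b)]) @ a # w) (u @ w)"
    by (simp add: a)
  from pres_eq.trans[OF this u] show ?case by blast
qed

lemma group_presented_group: "group (presented_group R)"
proof (rule groupI)
  show "\<exists>y\<in>carrier (presented_group R).
      y \<otimes>\<^bsub>presented_group R\<^esub> x = \<one>\<^bsub>presented_group R\<^esub>"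
    if x: "x \<in> carrier (presented_group R)" for x
  proof -
    from x obtain w where w: "x = pres_class R w"
      by (auto simp: carrier_presented_group)
    obtain u where "pres_eq R (u @ w) []"
      using pres_eq_left_inverse by blast
    then have "pres_class R u \<otimes>\<^bsub>presented_group R\<^esub> x = \<one>\<^bsub>presented_group R\<^esub>"
      by (simp only: w mult_presented_group one_presented_group pres_class_eq_iff)
    then show ?thesis
      by (rule bexI) (simp only: carrier_presented_group rangeI)
  qed
qed (auto simp only: carrier_presented_group mult_presented_group one_presented_group
    rangeI append_assoc append_Nil)

section \<open>The generalized quaternion group\<close>

datatype quat_gen = Gen_x | Gen_y

definition quat_relations :: "nat \<Rightarrow> (quat_gen word \<times> quat_gen word) set" where
  "quat_relations n =
     {(replicate n (Gen_x, True), replicate 2 (Gen_y, True)),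
      (replicate (2 * n) (Gen_x, True), []),
      ([(Gen_y, False), (Gen_x, True), (Gen_y, True)], [(Gen_x, False)])}"

definition Quat :: "nat \<Rightarrow> quat_gen word set monoid" where
  "Quat n = presented_group (quat_relations n)"

definition quat_x :: "nat \<Rightarrow> quat_gen word set" where
  "quat_x n = pres_class (quat_relations n) [(Gen_x, True)]"

definition quat_y :: "nat \<Rightarrow> quat_gen word set" where
  "quat_y n = pres_class (quat_relations n) [(Gen_y, True)]"

section \<open>Cayley graphs and perfect codes\<close>

text \<open>
  Undirected graphs are represented, as usual in \<open>Graph_Theory\<close>, by symmetric loop-free
  digraphs.
\<close>

definition connection_set :: "('a, 'b) monoid_scheme \<Rightarrow> 'a set \<Rightarrow> bool" where
  "connection_set G S \<longleftrightarrow>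
     S \<subseteq> carrier G \<and> (\<forall>s\<in>S. inv\<^bsub>G\<^esub> s \<in> S) \<and> \<one>\<^bsub>G\<^esub> \<notin> S"

definition cayley_graph :: "('a, 'b) monoid_scheme \<Rightarrow> 'a set \<Rightarrow> 'a pair_pre_digraph" where
  "cayley_graph G S =
     \<lparr>pverts = carrier G,
      parcs = {(u, v). u \<in> carrier G \<and> v \<in> carrier G \<and> u \<noteq> v \<and> v \<otimes>\<^bsub>G\<^esub> inv\<^bsub>G\<^esub> u \<in> S}\<rparr>"

lemma cayley_graph_bidirected:
  assumes "group G" "connection_set G S"
  shows "pair_bidirected_digraph (cayley_graph G S)"
proof -
  interpret group G by fact
  have "u \<otimes>\<^bsub>G\<^esub> inv\<^bsub>G\<^esub> v \<in> S"
    if "u \<in> carrier G" "v \<in> carrier G" "v \<otimes>\<^bsub>G\<^esub> inv\<^bsub>G\<^esub> u \<in> S" for u v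
  proof -
    have "inv\<^bsub>G\<^esub> (v \<otimes>\<^bsub>G\<^esub> inv\<^bsub>G\<^esub> u) = u \<otimes>\<^bsub>G\<^esub> inv\<^bsub>G\<^esub> v"
      using that by (simp add: inv_mult_group)
    then show ?thesis
      using assms(2) that(3) unfolding connection_set_def by metis
  qed
  then show ?thesis
    by unfold_locales (auto simp: cayley_graph_def symmetric_def sym_def)
qed

definition perfect_code :: "'a pair_pre_digraph \<Rightarrow> 'a set \<Rightarrow> bool" where
  "perfect_code \<Gamma> C \<longleftrightarrow>
     C \<subseteq> pverts \<Gamma> \<and>
     (\<forall>u\<in>C. \<forall>v\<in>C. (u, v) \<notin> parcs \<Gamma>) \<and>
     (\<forall>v\<in>pverts \<Gamma> - C. \<exists>!u. u \<in> C \<and> (u, v) \<in> parcs \<Gamma>)"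

definition group_perfect_code :: "('a, 'b) monoid_scheme \<Rightarrow> 'a set \<Rightarrow> bool" where
  "group_perfect_code G C \<longleftrightarrow>
     (\<exists>S. connection_set G S \<and> perfect_code (cayley_graph G S) C)"

section \<open>The two explicit connection sets\<close>

text \<open>
  In the first set the exponent \<open>t\<close> is meant to be even and positive, so \<open>t div 2 - 1\<close> is not
  truncated; the element \<open>x\<^sup>n\<close> belongs to it even if the index range is empty, that is for
  \<open>t = 2\<close>.
\<close>

definition quat_conn_a :: "nat \<Rightarrow> nat \<Rightarrow> quat_gen word set set" where
  "quat_conn_a n t =
     (let Q = Quat n; x = quat_x n; y = quat_y n in
      {x [^]\<^bsub>Q\<^esub> n} \<union>
      {x [^]\<^bsub>Q\<^esub> i | i :: nat. 1 \<le> i \<and> i \<le> t div 2 - 1} \<union>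
      {inv\<^bsub>Q\<^esub> (x [^]\<^bsub>Q\<^esub> i) | i :: nat. 1 \<le> i \<and> i \<le> t div 2 - 1} \<union>
      {x [^]\<^bsub>Q\<^esub> i \<otimes>\<^bsub>Q\<^esub> y | i :: nat. i \<le> t div 2 - 1} \<union>
      {x [^]\<^bsub>Q\<^esub> (n + i) \<otimes>\<^bsub>Q\<^esub> y | i :: nat. i \<le> t div 2 - 1})"

definition quat_conn_b :: "nat \<Rightarrow> nat \<Rightarrow> quat_gen word set set" where
  "quat_conn_b n t =
     (let Q = Quat n; x = quat_x n in
      {x [^]\<^bsub>Q\<^esub> i | i :: nat. 1 \<le> i \<and> i \<le> (t - 1) div 2} \<union>
      {inv\<^bsub>Q\<^esub> (x [^]\<^bsub>Q\<^esub> i) | i :: nat. 1 \<le> i \<and> i \<le> (t - 1) div 2})"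

end

theory Submission
  imports Defs
begin

text \<open>
  A subgroup \<open>H\<close> is a perfect code of \<open>Cay(G, S)\<close> iff \<open>S \<union> {e}\<close> is a left transversal of
  \<open>H\<close> with \<open>S \<inter> H = {}\<close>.  Every element of \<open>Q\<^sub>4\<^sub>n\<close> is \<open>x\<^sup>a\<close> or \<open>x\<^sup>a y\<close> with \<open>a\<close> unique
  modulo \<open>2 n\<close>, so for the two families of subgroups the transversal property of the given sets
  is a statement about residues modulo \<open>t\<close>; in case (a) it uses that \<open>n\<close> is congruent to
  \<open>t / 2\<close> modulo \<open>t\<close>.  Conversely, if \<open>g \<notin> H\<close> normalizes \<open>H\<close> and \<open>g\<^sup>2 \<in> H\<close>, the coset \<open>g H\<close>
  is closed under inverses, so its only element of \<open>S\<close> is an involution, hence equal to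
  \<open>x\<^sup>n\<close>.  If \<open>x\<^sup>n \<in> H\<close> this is absurd; it excludes the remaining subgroups with \<open>g = y\<close>
  for \<open>\<langle>x\<^sup>t\<rangle>\<close> and \<open>g = x\<^bsup>t/2\<^esup>\<close> for \<open>\<langle>x\<^sup>t, x\<^sup>s y\<rangle>\<close>.
\<close>

section \<open>Perfect codes that are subgroups\<close>

context group begin

lemma inv_mult_cancel:
  assumes "a \<in> carrier G" "z \<in> carrier G"
  shows "inv a \<otimes> (a \<otimes> z) = z" "a \<otimes> (inv a \<otimes> z) = z"
  using assms by (simp_all add: m_assoc[symmetric])

text \<open>As \<open>u\<close> and \<open>v\<close> are adjacent iff \<open>v u^-1\<close> lies in
  \<open>S\<close>, the neighbours of \<open>v\<close> in \<open>H\<close> are the elements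
  \<open>s^-1 v\<close> of \<open>H\<close> with \<open>s\<close> in \<open>S\<close>. Existence is
  \<open>cover\<close>, uniqueness is \<open>inj\<close>, and independence holds because quotients
  of elements of \<open>H\<close> stay in \<open>H\<close>, away from \<open>S\<close>.\<close>

lemma perfect_code_cayley_graphI:
  assumes H: "subgroup H G" and S: "S \<subseteq> carrier G" "S \<inter> H = {}"
    and cover: "\<And>v. v \<in> carrier G \<Longrightarrow> v \<notin> H \<Longrightarrow> \<exists>s\<in>S. inv s \<otimes> v \<in> H"
    and inj: "\<And>s s'. s \<in> S \<Longrightarrow> s' \<in> S \<Longrightarrow> inv s \<otimes> s' \<in> H \<Longrightarrow> s = s'"
  shows "perfect_code (cayley_graph G S) H"
  unfolding perfect_code_def
proof (intro conjI ballI)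
  have HG: "H \<subseteq> carrier G" using H by (rule subgroup.subset)
  then show "H \<subseteq> pverts (cayley_graph G S)" by (simp add: cayley_graph_def)
  show "(u, v) \<notin> parcs (cayley_graph G S)" if "u \<in> H" "v \<in> H" for u v
  proof -
    have "v \<otimes> inv u \<in> H" using that H by (simp add: subgroup.m_closed subgroup.m_inv_closed)
    then show ?thesis using S(2) by (auto simp: cayley_graph_def)
  qed
  fix v assume v: "v \<in> pverts (cayley_graph G S) - H"
  then have vG: "v \<in> carrier G" and vH: "v \<notin> H" by (auto simp: cayley_graph_def)
  then obtain s where s: "s \<in> S" "inv s \<otimes> v \<in> H" using cover by blast
  have sG: "s \<in> carrier G" using s(1) S(1) by blast
  show "\<exists>!u. u \<in> H \<and> (u, v) \<in> parcs (cayley_graph G S)"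
  proof (rule ex1I[of _ "inv s \<otimes> v"])
    have "v \<otimes> inv (inv s \<otimes> v) = s"
      using vG sG by (simp add: inv_mult_group m_assoc[symmetric])
    then show "inv s \<otimes> v \<in> H \<and> (inv s \<otimes> v, v) \<in> parcs (cayley_graph G S)"
      using s vG vH sG by (auto simp: cayley_graph_def)
  next
    fix u assume "u \<in> H \<and> (u, v) \<in> parcs (cayley_graph G S)"
    then have u: "u \<in> H" "u \<in> carrier G" "v \<otimes> inv u \<in> S" by (auto simp: cayley_graph_def)
    have "inv s \<otimes> (v \<otimes> inv u) = (inv s \<otimes> v) \<otimes> inv u"
      using sG vG u(2) by (simp add: m_assoc)
    also have "\<dots> \<in> H"
      using s(2) u(1) H by (simp add: subgroup.m_closed subgroup.m_inv_closed)
    finally have "s = v \<otimes> inv u" using inj s(1) u(3) by blast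
    then show "u = inv s \<otimes> v"
      using vG u(2) by (simp add: inv_mult_group m_assoc)
  qed
qed

text \<open>
  The neighbour of the identity in the coset \<open>g H\<close> is the only element of the connection
  set in that coset; the coset is closed under inverses, so this element is its own inverse.
\<close>

lemma group_perfect_code_involution:
  assumes H: "subgroup H G" and code: "group_perfect_code G H"
    and g: "g \<in> carrier G" "g \<notin> H" "g \<otimes> g \<in> H"
    and conj: "\<And>h. h \<in> H \<Longrightarrow> g \<otimes> h \<otimes> inv g \<in> H"
  shows "\<exists>h\<in>H. (g \<otimes> h) \<otimes> (g \<otimes> h) = \<one>"
proof -
  from code obtain S where S: "connection_set G S" and pc: "perfect_code (cayley_graph G S) H"
    by (auto simp: group_perfect_code_def)
  have HG: "h \<in> carrier G" if "h \<in> H" for h using that H subgroup.subset by blast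
  have unique: "\<exists>!u. u \<in> H \<and> g \<otimes> inv u \<in> S"
  proof -
    have "\<exists>!u. u \<in> H \<and> (u, g) \<in> parcs (cayley_graph G S)"
      using pc g by (auto simp: perfect_code_def cayley_graph_def)
    moreover have "u \<in> H \<and> (u, g) \<in> parcs (cayley_graph G S) \<longleftrightarrow> u \<in> H \<and> g \<otimes> inv u \<in> S" for u
      using g HG by (auto simp: cayley_graph_def)
    ultimately show ?thesis by simp
  qed
  then obtain u where u: "u \<in> H" "g \<otimes> inv u \<in> S" by blast
  note uG = HG[OF u(1)]
  \<comment> \<open>Chosen so that the inverse of \<open>g u^-1\<close> is \<open>g u'^-1\<close>;
    this inverse lies in \<open>S\<close>, so uniqueness in the coset will force
    \<open>u' = u\<close>.\<close>
  define u' where "u' = g \<otimes> inv u \<otimes> g"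
  have "u' = (g \<otimes> inv u \<otimes> inv g) \<otimes> (g \<otimes> g)"
    using g(1) uG by (simp add: u'_def m_assoc inv_mult_cancel)
  then have u'H: "u' \<in> H"
    using H g(3) conj[of "inv u"] u(1) by (simp add: subgroup.m_closed subgroup.m_inv_closed)
  have "inv (g \<otimes> inv u) = g \<otimes> inv u'"
    using g(1) uG by (simp add: u'_def inv_mult_group m_assoc[symmetric])
  moreover have "inv (g \<otimes> inv u) \<in> S" using S u(2) by (simp add: connection_set_def)
  ultimately have "g \<otimes> inv u' \<in> S" by simp
  then have "u' = u" using unique u u'H by blast
  then have "(g \<otimes> inv u) \<otimes> (g \<otimes> inv u) = \<one>"
    using g(1) uG by (simp add: u'_def m_assoc[symmetric])
  then show ?thesis by (rule bexI) (rule subgroup.m_inv_closed[OF H u(1)])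
qed

end

section \<open>Normal forms in the generalized quaternion group\<close>

text \<open>The relations alone also hold in quotients of \<open>Q_{4n}\<close>;
  \<open>ord_x\<close> and \<open>y_not_power\<close> exclude the proper ones. The arguments on
  subgroups then need no words.\<close>

locale generalized_quaternion = group +
  fixes n :: nat and x y :: 'a
  assumes n_pos: "n > 0"
    and x_closed [simp]: "x \<in> carrier G"
    and y_closed [simp]: "y \<in> carrier G"
    and y_square: "y \<otimes> y = x [^] n"
    and y_conj: "inv y \<otimes> x \<otimes> y = inv x"
    and ord_x: "ord x = 2 * n"
    and y_not_power: "y \<notin> range (\<lambda>k::int. x [^] k)"
    and generated: "carrier G = generate G {x, y}"
begin

text \<open>Exponents are integers rather than residues, so products need no reduction and equality
  becomes divisibility by \<open>2 * n\<close>.\<close>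

definition el :: "int \<Rightarrow> bool \<Rightarrow> 'a" where
  "el a b = x [^] a \<otimes> (if b then y else \<one>)"

lemma el_closed [simp]: "el a b \<in> carrier G"
  by (simp add: el_def)

text \<open>Conjugation by \<open>y\<close> is a homomorphism that inverts \<open>x\<close>, hence
  it inverts every power of \<open>x\<close>.\<close>

lemma y_power: "y \<otimes> x [^] (k::int) = x [^] (- k) \<otimes> y"
proof -
  have "group_hom G G (\<lambda>g. inv y \<otimes> g \<otimes> y)"
    by unfold_locales (auto simp: hom_def m_assoc inv_mult_cancel)
  from group_hom.hom_int_pow[OF this x_closed, of "- k"]
  have "inv y \<otimes> x [^] (- k) \<otimes> y = (inv y \<otimes> x \<otimes> y) [^] (- k)" .
  also have "\<dots> = x [^] k" by (simp add: y_conj int_pow_inv int_pow_neg)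
  finally have "y \<otimes> x [^] k = y \<otimes> (inv y \<otimes> x [^] (- k) \<otimes> y)" by simp
  also have "\<dots> = x [^] (- k) \<otimes> y" by (simp add: m_assoc[symmetric])
  finally show ?thesis .
qed

text \<open>Moving \<open>y\<close> past \<open>x^c\<close> negates \<open>c\<close>, and two
  factors \<open>y\<close> merge into \<open>x^n\<close>.\<close>

lemma el_mult:
  "el a b \<otimes> el c d = el (a + (if b then - c else c) + (if b \<and> d then int n else 0)) (b \<noteq> d)"
proof -
  have xn: "y \<otimes> y = x [^] int n" by (simp add: y_square int_pow_int)
  have "el a True \<otimes> el c True = x [^] a \<otimes> (y \<otimes> x [^] c) \<otimes> y" by (simp add: el_def m_assoc)
  also have "\<dots> = x [^] a \<otimes> x [^] (- c) \<otimes> (y \<otimes> y)" by (simp add: y_power m_assoc)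
  also have "\<dots> = el (a - c + int n) False" by (simp add: xn el_def int_pow_mult[symmetric])
  finally have TT: "el a True \<otimes> el c True = el (a - c + int n) False" .
  have "el a True \<otimes> el c False = x [^] a \<otimes> (y \<otimes> x [^] c)" by (simp add: el_def m_assoc)
  also have "\<dots> = el (a - c) True"
    by (simp add: y_power el_def int_pow_mult[symmetric] m_assoc[symmetric])
  finally have TF: "el a True \<otimes> el c False = el (a - c) True" .
  show ?thesis
    using TT TF by (cases b; cases d) (simp_all add: el_def int_pow_mult[symmetric] m_assoc[symmetric])
qed

lemma el_eq_iff: "el a b = el c d \<longleftrightarrow> b = d \<and> 2 * int n dvd a - c"
proof -
  have eq: "x [^] a = x [^] c \<longleftrightarrow> 2 * int n dvd a - c" for a c :: int
    using int_pow_eq[OF x_closed, of a c] ord_x by (simp add: dvd_diff_commute)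
  have ne: "x [^] a \<otimes> y \<noteq> x [^] c" for a c :: int
  proof
    assume "x [^] a \<otimes> y = x [^] c"
    then have "y = inv (x [^] a) \<otimes> x [^] c" by (simp add: inv_solve_left)
    also have "\<dots> = x [^] (c - a)" by (simp add: int_pow_neg[symmetric] int_pow_mult[symmetric])
    finally show False using y_not_power by blast
  qed
  show ?thesis
    using eq ne ne[symmetric] by (cases b; cases d) (simp_all add: el_def)
qed

lemma one_eq_el: "\<one> = el 0 False"
  by (simp add: el_def)

lemma inv_el: "inv (el a b) = el (if b then a + int n else - a) b"
  by (rule inv_equality) (simp_all add: el_mult one_eq_el el_eq_iff)

lemma power_eq_el: "x [^] (k::nat) = el (int k) False"
  by (simp add: el_def int_pow_int)

lemma carrier_eq_el: "carrier G = range (case_prod el)"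
proof
  have xy: "x \<in> range (case_prod el)" "y \<in> range (case_prod el)"
    by (rule image_eqI[OF _ UNIV_I, of _ _ "(1, False)"], simp add: el_def)
      (rule image_eqI[OF _ UNIV_I, of _ _ "(0, True)"], simp add: el_def)
  have "g \<in> range (case_prod el)" if "g \<in> generate G {x, y}" for g
    using that
  proof induction
    case one
    show ?case by (rule image_eqI[OF _ UNIV_I, of _ _ "(0, False)"]) (simp add: one_eq_el)
  next
    case (incl h)
    then show ?case using xy by blast
  next
    case (inv h)
    then have "h \<in> range (case_prod el)" using xy by blast
    then show ?case by (force simp: inv_el)
  next
    case (eng h1 h2)
    then show ?case by (force simp: el_mult)
  qed
  then show "carrier G \<subseteq> range (case_prod el)" using generated by blast
qed auto

lemma carrierE:
  assumes "g \<in> carrier G"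
  obtains a b where "g = el a b"
  using assms by (auto simp: carrier_eq_el)

end

section \<open>The action of words on normal forms\<close>

text \<open>
  Left multiplication by a letter in terms of normal forms: the pair \<open>(a, b)\<close> stands for
  \<open>x\<^sup>a\<close> or \<open>x\<^sup>a y\<close> according to \<open>b\<close>.  Each letter acts as a bijection of
  \<open>int \<times> bool\<close>, but the relations only hold modulo \<open>2 * n\<close> in the first component.
\<close>

fun quat_act :: "nat \<Rightarrow> quat_gen \<times> bool \<Rightarrow> int \<times> bool \<Rightarrow> int \<times> bool" where
  "quat_act n (Gen_x, True) (a, b) = (a + 1, b)"
| "quat_act n (Gen_x, False) (a, b) = (a - 1, b)"
| "quat_act n (Gen_y, True) (a, b) = ((if b then int n else 0) - a, \<not> b)"
| "quat_act n (Gen_y, False) (a, b) = ((if b then 0 else int n) - a, \<not> b)"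

definition quat_cong :: "nat \<Rightarrow> int \<times> bool \<Rightarrow> int \<times> bool \<Rightarrow> bool" where
  "quat_cong n p q \<longleftrightarrow> snd p = snd q \<and> 2 * int n dvd fst p - fst q"

lemma quat_cong_refl: "quat_cong n p p"
  by (simp add: quat_cong_def)

lemma quat_cong_sym: "quat_cong n p q \<Longrightarrow> quat_cong n q p"
  by (simp add: quat_cong_def dvd_diff_commute)

lemma quat_cong_trans: "quat_cong n p q \<Longrightarrow> quat_cong n q r \<Longrightarrow> quat_cong n p r"
  unfolding quat_cong_def using dvd_add[of "2 * int n" "fst p - fst q" "fst q - fst r"] by simp

lemma quat_act_cong:
  assumes "quat_cong n p q"
  shows "quat_cong n (quat_act n l p) (quat_act n l q)"
proof -
  obtain a b where p: "p = (a, b)" by force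
  obtain c where q: "q = (c, b)" and ac: "2 * int n dvd a - c"
    using assms by (cases q) (simp add: p quat_cong_def)
  have ca: "2 * int n dvd c - a" using ac by (simp only: dvd_diff_commute)
  obtain g e where l: "l = (g, e)" by force
  show ?thesis
    using ac ca by (cases g; cases e) (simp_all add: l p q quat_cong_def)
qed

lemma foldr_quat_act_cong:
  "quat_cong n p q \<Longrightarrow> quat_cong n (foldr (quat_act n) w p) (foldr (quat_act n) w q)"
  by (induction w) (auto intro: quat_act_cong)

lemma quat_act_x_power:
  "(quat_act n (Gen_x, True) ^^ k) (a, b) = (a + int k, b)"
  by (induction k) auto

text \<open>This invariant bounds the presented group from below: words whose actions on some pair
  are not congruent name different elements. The start \<open>p\<close> is arbitrary because in a
  concatenation the left word acts on the result of the right one.\<close>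

lemma pres_eq_quat_act:
  assumes "pres_eq (quat_relations n) u v"
  shows "quat_cong n (foldr (quat_act n) u p) (foldr (quat_act n) v p)"
  using assms
proof (induction arbitrary: p)
  case (refl u)
  show ?case by (rule quat_cong_refl)
next
  case (sym u v)
  then show ?case by (blast intro: quat_cong_sym)
next
  case (trans u v w)
  then show ?case by (blast intro: quat_cong_trans)
next
  case (append u u' v v')
  have "quat_cong n (foldr (quat_act n) u (foldr (quat_act n) v p))
      (foldr (quat_act n) u (foldr (quat_act n) v' p))"
    using append by (intro foldr_quat_act_cong)
  from quat_cong_trans[OF this append.IH(1)] show ?case by simp
next
  case (cancel g b)
  show ?case by (cases p; cases g; cases b) (auto simp: quat_cong_refl)
next
  case (relation u v)
  obtain a b where p: "p = (a, b)" by force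
  from relation show ?case
    unfolding quat_relations_def
    by (auto simp: p quat_act_x_power numeral_2_eq_2 quat_cong_def)
qed

section \<open>The presented group satisfies the axioms of the locale\<close>

lemma group_Quat: "group (Quat n)"
  by (simp add: Quat_def group_presented_group)

lemma quat_x_power:
  "quat_x n [^]\<^bsub>Quat n\<^esub> (k::nat) = pres_class (quat_relations n) (replicate k (Gen_x, True))"
proof -
  interpret group "Quat n" by (rule group_Quat)
  show ?thesis
  proof (induction k)
    case 0
    show ?case by (simp add: Quat_def one_presented_group)
  next
    case (Suc k)
    then show ?case
      by (simp add: Quat_def quat_x_def mult_presented_group replicate_append_same)
  qed
qed

lemma generalized_quaternion_Quat:
  assumes "n > 0"
  shows "generalized_quaternion (Quat n) n (quat_x n) (quat_y n)"
proof -
  interpret group "Quat n" by (rule group_Quat)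
  let ?c = "pres_class (quat_relations n)"
  have closed: "?c w \<in> carrier (Quat n)" for w
    by (simp add: Quat_def carrier_presented_group)
  have mult: "?c u \<otimes>\<^bsub>Quat n\<^esub> ?c v = ?c (u @ v)" for u v
    by (simp add: Quat_def mult_presented_group)
  have one: "\<one>\<^bsub>Quat n\<^esub> = ?c []"
    by (simp add: Quat_def one_presented_group)
  have inv: "inv\<^bsub>Quat n\<^esub> (?c [(g, True)]) = ?c [(g, False)]" for g
    using pres_eq.cancel[of "quat_relations n" g False] closed
    by (intro inv_equality) (simp_all add: mult one pres_class_eq_iff)
  have rel: "?c u = ?c v" if "(u, v) \<in> quat_relations n" for u v
    using that by (simp add: pres_class_eq_iff pres_eq.relation)
  have xG: "quat_x n \<in> carrier (Quat n)" and yG: "quat_y n \<in> carrier (Quat n)"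
    by (simp_all add: quat_x_def quat_y_def closed)
  have "2 * n dvd k" if "quat_x n [^]\<^bsub>Quat n\<^esub> k = \<one>\<^bsub>Quat n\<^esub>" for k :: nat
  proof -
    have "pres_eq (quat_relations n) (replicate k (Gen_x, True)) []"
      using that by (simp add: quat_x_power one pres_class_eq_iff)
    \<comment> \<open>The pair \<open>(0, False)\<close> stands for the identity; \<open>x^k\<close>
      sends it to \<open>(k, False)\<close>, which must be congruent to it.\<close>
    from pres_eq_quat_act[OF this, of "(0, False)"]
    have "int (2 * n) dvd int k" by (simp add: quat_act_x_power quat_cong_def)
    then show ?thesis by (simp only: int_dvd_int_iff)
  qed
  moreover have "quat_x n [^]\<^bsub>Quat n\<^esub> (2 * n) = \<one>\<^bsub>Quat n\<^esub>"
    unfolding quat_x_power one by (rule rel) (simp add: quat_relations_def)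
  ultimately have ord: "ord (quat_x n) = 2 * n"
    using xG by (intro dvd_antisym) (simp_all add: pow_eq_id)
  show ?thesis
  proof unfold_locales
    show "quat_y n \<otimes>\<^bsub>Quat n\<^esub> quat_y n = quat_x n [^]\<^bsub>Quat n\<^esub> n"
      unfolding quat_x_power quat_y_def mult
      by (rule rel[symmetric]) (simp add: quat_relations_def numeral_2_eq_2)
    show "inv\<^bsub>Quat n\<^esub> quat_y n \<otimes>\<^bsub>Quat n\<^esub> quat_x n \<otimes>\<^bsub>Quat n\<^esub> quat_y n = inv\<^bsub>Quat n\<^esub> quat_x n"
      unfolding quat_x_def quat_y_def mult inv
      by (rule rel) (simp add: quat_relations_def)
    show "quat_y n \<notin> range (\<lambda>k::int. quat_x n [^]\<^bsub>Quat n\<^esub> k)"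
    proof
      assume "quat_y n \<in> range (\<lambda>k::int. quat_x n [^]\<^bsub>Quat n\<^esub> k)"
      then obtain k :: int where "quat_y n = quat_x n [^]\<^bsub>Quat n\<^esub> k" by blast
      \<comment> \<open>Reducing the exponent modulo \<open>2 * n\<close> makes it a natural number,
        so the power is the class of a word in \<open>x\<close> alone. Such a word preserves the
        boolean component, whereas \<open>y\<close> flips it.\<close>
      also have "\<dots> = quat_x n [^]\<^bsub>Quat n\<^esub> int (nat (k mod (2 * int n)))"
        using assms xG by (simp add: int_pow_eq ord mod_eq_dvd_iff[symmetric])
      finally have "pres_eq (quat_relations n) [(Gen_y, True)]
          (replicate (nat (k mod (2 * int n))) (Gen_x, True))"
        by (simp only: int_pow_int quat_x_power quat_y_def pres_class_eq_iff)
      from pres_eq_quat_act[OF this, of "(0, False)"] show False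
        by (simp add: quat_act_x_power quat_cong_def)
    qed
    have "?c w \<in> generate (Quat n) {quat_x n, quat_y n}" for w
    proof (induction w)
      case Nil
      show ?case using generate.one[of "Quat n"] by (simp add: one)
    next
      case (Cons l w)
      obtain g b where l: "l = (g, b)" by force
      have "?c [l] \<in> generate (Quat n) {quat_x n, quat_y n}"
      proof (cases b)
        case True
        then show ?thesis
          unfolding l by (cases g) (auto simp: quat_x_def quat_y_def intro: generate.incl)
      next
        case False
        have "?c [(g, True)] \<in> {quat_x n, quat_y n}"
          by (cases g) (simp_all add: quat_x_def quat_y_def)
        then have "inv\<^bsub>Quat n\<^esub> (?c [(g, True)]) \<in> generate (Quat n) {quat_x n, quat_y n}"
          by (rule generate.inv)
        then show ?thesis using False by (simp add: l inv)
      qed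
      from generate.eng[OF this Cons.IH] show ?case by (simp add: mult)
    qed
    then have "carrier (Quat n) \<subseteq> generate (Quat n) {quat_x n, quat_y n}"
      unfolding Quat_def carrier_presented_group by blast
    moreover have "generate (Quat n) {quat_x n, quat_y n} \<subseteq> carrier (Quat n)"
      using xG yG by (intro generate_incl) simp
    ultimately show "carrier (Quat n) = generate (Quat n) {quat_x n, quat_y n}" by blast
  qed (use assms xG yG ord in simp_all)
qed

context generalized_quaternion begin

section \<open>Subgroups\<close>

lemma el_power: "el a False [^] (k::int) = el (a * k) False"
  by (simp add: el_def int_pow_pow)

lemma subset_eqI:
  assumes "H \<subseteq> carrier G" "K \<subseteq> carrier G" "\<And>a b. el a b \<in> H \<longleftrightarrow> el a b \<in> K"
  shows "H = K"
proof -
  have "g \<in> H \<longleftrightarrow> g \<in> K" if "g \<in> carrier G" for g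
    using that by (rule carrierE) (simp add: assms(3))
  then show ?thesis using assms(1,2) by blast
qed

text \<open>Exponents matter only modulo \<open>2 * n\<close>; as \<open>t\<close> divides
  \<open>2 * n\<close>, divisibility of the exponent by \<open>t\<close> does not depend on the
  representative.\<close>

lemma el_in_generate_cyclic:
  assumes "t dvd 2 * n"
  shows "el a b \<in> generate G {x [^] t} \<longleftrightarrow> \<not> b \<and> int t dvd a"
proof -
  have gen: "generate G {x [^] t} = {el (int t * k) False | k. True}"
    by (simp add: generate_pow power_eq_el el_power)
  have t2n: "int t dvd 2 * int n" using assms int_dvd_int_iff[of t "2 * n"] by simp
  show ?thesis
  proof
    assume "el a b \<in> generate G {x [^] t}"
    then obtain k where k: "\<not> b" "2 * int n dvd a - int t * k"
      by (auto simp: gen el_eq_iff)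
    have "int t dvd (a - int t * k) + int t * k"
      using dvd_trans[OF t2n k(2)] by (rule dvd_add) simp
    then show "\<not> b \<and> int t dvd a" using k(1) by simp
  qed (auto simp: gen dvd_def)
qed

lemma el_in_generate_dicyclic:
  assumes "t dvd n"
  shows "el a b \<in> generate G {x [^] t, x [^] s \<otimes> y} \<longleftrightarrow> int t dvd a - (if b then int s else 0)"
proof -
  \<comment> \<open>The expected explicit form of the generated subgroup; \<open>K\<close> is shown
    to be the least subgroup containing both generators. Closure uses that \<open>t\<close> divides
    \<open>n\<close>, because \<open>y^2 = x^n\<close>.\<close>
  define K where "K = {el a b | a b. int t dvd a - (if b then int s else 0)}"
  have tn: "int t dvd int n" using assms by simp
  have mem: "el a b \<in> K \<longleftrightarrow> int t dvd a - (if b then int s else 0)" for a b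
  proof
    assume "el a b \<in> K"
    then obtain c where c: "int t dvd c - (if b then int s else 0)" "2 * int n dvd a - c"
      unfolding K_def by (auto simp: el_eq_iff)
    have "int t dvd a - c" using c(2) tn by (meson dvd_trans dvd_triv_right)
    from dvd_add[OF this c(1)] show "int t dvd a - (if b then int s else 0)" by simp
  qed (unfold K_def, blast)
  have K: "subgroup K G"
  proof (rule subgroupI)
    show "K \<subseteq> carrier G" by (auto simp: K_def)
    show "K \<noteq> {}" using mem[of 0 False] by auto
    show "inv g \<in> K" if gK: "g \<in> K" for g
    proof -
      obtain a b where g: "g = el a b" using gK unfolding K_def by blast
      have 1: "int t dvd a - (if b then int s else 0)" using gK by (simp only: g mem)
      show ?thesis
        using 1 dvd_add[OF 1 tn] by (cases b) (simp_all add: g inv_el mem algebra_simps)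
    qed
    show "g \<otimes> g' \<in> K" if gK: "g \<in> K" "g' \<in> K" for g g'
    proof -
      obtain a b where g: "g = el a b" using gK(1) unfolding K_def by blast
      obtain c d where g': "g' = el c d" using gK(2) unfolding K_def by blast
      have 1: "int t dvd a - (if b then int s else 0)" using gK(1) by (simp only: g mem)
      have 2: "int t dvd c - (if d then int s else 0)" using gK(2) by (simp only: g' mem)
      show ?thesis
        \<comment> \<open>The sum serves a left factor without \<open>y\<close>, the difference a
          left factor with \<open>y\<close>, and the added \<open>n\<close> the case where both
          factors contain \<open>y\<close>.\<close>
        using dvd_add[OF 1 2] dvd_diff[OF 1 2] dvd_add[OF dvd_diff[OF 1 2] tn]
        by (cases b; cases d) (simp_all add: g g' el_mult mem algebra_simps)
    qed
  qed
  have gens: "{x [^] t, x [^] s \<otimes> y} = {el (int t) False, el (int s) True}"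
    by (simp add: el_def int_pow_int)
  have "K = generate G {x [^] t, x [^] s \<otimes> y}"
    unfolding gens
  proof (rule generateI[OF K])
    show "{el (int t) False, el (int s) True} \<subseteq> K" by (simp add: mem)
    fix L assume L: "subgroup L G" "{el (int t) False, el (int s) True} \<subseteq> L"
    have pow: "el (int t * k) False \<in> L" for k
      using L subgroup_int_pow_closed[of L "el (int t) False" k] by (simp add: el_power)
    have "el (int t * k) False \<otimes> el (int s) True \<in> L" for k
      using L pow subgroup.m_closed[OF L(1)] by simp
    then have pow_y: "el (int t * k + int s) True \<in> L" for k by (simp add: el_mult)
    show "K \<subseteq> L"
    proof
      fix g assume "g \<in> K"
      then obtain a b where g: "g = el a b" and "int t dvd a - (if b then int s else 0)"
        unfolding K_def by blast
      then obtain k where "a = int t * k + (if b then int s else 0)"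
        by (auto simp: dvd_def diff_eq_eq)
      then show "g \<in> L" using pow pow_y by (cases b) (simp_all add: g)
    qed
  qed
  then show ?thesis using mem by simp
qed

lemma subgroup_cases:
  assumes H: "subgroup H G"
  obtains (cyclic) t where "t > 0" "t dvd 2 * n" "H = generate G {x [^] t}"
  | (dicyclic) t s where "t > 0" "t dvd n" "s < t" "H = generate G {x [^] t, x [^] s \<otimes> y}"
proof -
  have mult: "el (a + c) False \<in> H" if "el a False \<in> H" "el c False \<in> H" for a c
    using subgroup.m_closed[OF H that] by (simp add: el_mult)
  have one: "el (2 * int n) False = \<one>" by (simp add: one_eq_el el_eq_iff)
  have HG: "H \<subseteq> carrier G" using H by (rule subgroup.subset)
  \<comment> \<open>The least positive exponent of a power of \<open>x\<close> in \<open>H\<close>;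
    it exists since \<open>x^(2n)\<close> is the identity. Division with remainder then shows that
    the exponents occurring in \<open>H\<close> are the multiples of \<open>t\<close>.\<close>
  define t where "t = (LEAST t. t > 0 \<and> el (int t) False \<in> H)"
  have "2 * n > 0 \<and> el (int (2 * n)) False \<in> H"
    using n_pos subgroup.one_closed[OF H] one by simp
  then have t: "t > 0 \<and> el (int t) False \<in> H" unfolding t_def by (rule LeastI)
  have tmult: "el (int t * k) False \<in> H" for k
    using subgroup_int_pow_closed[OF H, of "el (int t) False" k] t by (simp add: el_power)
  have memF: "el a False \<in> H \<longleftrightarrow> int t dvd a" for a
  proof
    assume "el a False \<in> H"
    from mult[OF this tmult, of "- (a div int t)"]
    have "el (a mod int t) False \<in> H" by (simp add: minus_mult_div_eq_mod)
    then have "\<not> nat (a mod int t) > 0"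
      using t not_less_Least[of "nat (a mod int t)" "\<lambda>t. t > 0 \<and> el (int t) False \<in> H"]
      by (auto simp: t_def[symmetric] nat_less_iff)
    moreover have "0 \<le> a mod int t" using t by simp
    ultimately show "int t dvd a" by (simp add: dvd_eq_mod_eq_0)
  qed (use tmult in \<open>auto simp: dvd_def\<close>)
  have "int t dvd int (2 * n)"
    using memF[of "2 * int n"] one subgroup.one_closed[OF H] by simp
  then have t2n: "t dvd 2 * n" by (simp only: int_dvd_int_iff)
  show thesis
  proof (cases "\<exists>c. el c True \<in> H")
    case False
    have "H = generate G {x [^] t}"
    proof (rule subset_eqI[OF HG])
      show "generate G {x [^] t} \<subseteq> carrier G" by (rule generate_incl) auto
      show "el a b \<in> H \<longleftrightarrow> el a b \<in> generate G {x [^] t}" for a b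
        using False memF by (cases b) (simp_all add: el_in_generate_cyclic[OF t2n])
    qed
    then show thesis using cyclic t t2n by blast
  next
    case True
    then obtain c where c: "el c True \<in> H" by blast
    \<comment> \<open>The square of \<open>x^c y\<close> is \<open>x^n\<close>, which therefore lies
      in \<open>H\<close>.\<close>
    have "int t dvd int n"
      using subgroup.m_closed[OF H c c] memF by (simp add: el_mult)
    then have tn: "t dvd n" by simp
    define s where "s = nat (c mod int t)"
    have s: "int s = c mod int t" "s < t"
      using t pos_mod_sign[of "int t" c] pos_mod_bound[of "int t" c] by (auto simp: s_def nat_less_iff)
    have memT: "el a True \<in> H \<longleftrightarrow> int t dvd a - c" for a
    proof
      assume "el a True \<in> H"
      from subgroup.m_closed[OF H this c] have "int t dvd a - c + int n"
        using memF by (simp add: el_mult)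
      then show "int t dvd a - c" using \<open>int t dvd int n\<close> by (simp add: dvd_add_left_iff)
    next
      assume "int t dvd a - c"
      then have "el (a - c) False \<in> H" by (simp add: memF)
      from subgroup.m_closed[OF H this c] show "el a True \<in> H" by (simp add: el_mult)
    qed
    have "int t dvd a - c \<longleftrightarrow> int t dvd a - int s" for a
      by (simp add: s(1) mod_eq_dvd_iff[symmetric] mod_diff_right_eq)
    then have "H = generate G {x [^] t, x [^] s \<otimes> y}"
    proof (intro subset_eqI[OF HG])
      show "generate G {x [^] t, x [^] s \<otimes> y} \<subseteq> carrier G" by (rule generate_incl) auto
      assume *: "\<And>a. int t dvd a - c \<longleftrightarrow> int t dvd a - int s"
      show "el a b \<in> H \<longleftrightarrow> el a b \<in> generate G {x [^] t, x [^] s \<otimes> y}" for a b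
        using * memF memT by (cases b) (simp_all add: el_in_generate_dicyclic[OF tn])
    qed
    then show thesis using dicyclic t tn s(2) by blast
  qed
qed

section \<open>Subgroups that are not perfect codes\<close>

text \<open>The square of \<open>x^a y\<close> is \<open>x^n\<close>, not the identity, so an
  element with trivial square is a power of \<open>x^n\<close> and lies in \<open>H\<close>. The
  element \<open>g h\<close> of the coset cannot, since \<open>g\<close> is outside
  \<open>H\<close>.\<close>

lemma not_group_perfect_code:
  assumes H: "subgroup H G" and xn: "el (int n) False \<in> H"
    and g: "g \<in> carrier G" "g \<notin> H" "g \<otimes> g \<in> H"
    and conj: "\<And>h. h \<in> H \<Longrightarrow> g \<otimes> h \<otimes> inv g \<in> H"
  shows "\<not> group_perfect_code G H"
proof
  assume "group_perfect_code G H"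
  from group_perfect_code_involution[OF H this g conj]
  obtain h where h: "h \<in> H" "(g \<otimes> h) \<otimes> (g \<otimes> h) = \<one>" by blast
  have hG: "h \<in> carrier G" using h(1) H subgroup.subset by blast
  obtain a b where ab: "g \<otimes> h = el a b" using carrierE m_closed[OF g(1) hG] by metis
  have "\<not> b" "int n dvd a"
    using h(2) n_pos zdvd_not_zless[of "int n" "2 * int n"]
    by (auto simp: ab el_mult one_eq_el el_eq_iff zdvd_not_zless split: if_splits)
  then obtain k where "el a b = el (int n) False [^] (k::int)" by (auto simp: dvd_def el_power)
  then have "g \<otimes> h \<in> H" using subgroup_int_pow_closed[OF H xn] ab by simp
  from subgroup.m_closed[OF H this subgroup.m_inv_closed[OF H h(1)]]
  show False using g(1,2) hG by (simp add: m_assoc)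
qed

lemma not_group_perfect_code_cyclic:
  assumes "t dvd n"
  shows "\<not> group_perfect_code G (generate G {x [^] t})"
proof -
  let ?H = "generate G {x [^] t}"
  have t2n: "t dvd 2 * n" using assms by simp
  note mem = el_in_generate_cyclic[OF t2n]
  have H: "subgroup ?H G" by (rule generate_is_subgroup) auto
  show ?thesis
  proof (rule not_group_perfect_code[OF H, of "el 0 True"])
    show "el 0 True \<otimes> h \<otimes> inv (el 0 True) \<in> ?H" if hH: "h \<in> ?H" for h
    proof -
      obtain a b where h: "h = el a b" using carrierE subgroup.mem_carrier[OF H hH] by metis
      then show ?thesis using hH assms by (simp add: mem inv_el el_mult)
    qed
  qed (use assms in \<open>simp_all add: mem el_mult\<close>)
qed

lemma not_group_perfect_code_dicyclic:
  fixes s :: nat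
  assumes "t dvd n" "even t"
  shows "\<not> group_perfect_code G (generate G {x [^] t, x [^] s \<otimes> y})"
proof -
  let ?H = "generate G {x [^] t, x [^] s \<otimes> y}"
  note mem = el_in_generate_dicyclic[OF assms(1)]
  have H: "subgroup ?H G" by (rule generate_is_subgroup) auto
  obtain m where m: "t = 2 * m" using assms(2) by blast
  then have m_pos: "m > 0" using assms(1) n_pos by (cases m) auto
  show ?thesis
  proof (rule not_group_perfect_code[OF H, of "el (int m) False"])
    show "el (int m) False \<otimes> h \<otimes> inv (el (int m) False) \<in> ?H" if hH: "h \<in> ?H" for h
    proof -
      obtain a b where h: "h = el a b" using carrierE subgroup.mem_carrier[OF H hH] by metis
      have "int t dvd a - (if b then int s else 0)" using hH by (simp only: h mem)
      \<comment> \<open>Conjugation by \<open>x^m\<close> shifts the exponent of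
        \<open>x^a y\<close> by \<open>2 * m = t\<close>, which stays within the same residue class
        modulo \<open>t\<close>.\<close>
      moreover have "el (int m) False \<otimes> h \<otimes> inv (el (int m) False) = el (a + (if b then int t else 0)) b"
        by (simp add: h inv_el el_mult m add.commute)
      ultimately show ?thesis
        using dvd_add[of "int t" "a - int s" "int t"]
        by (cases b) (simp_all add: mem algebra_simps)
    qed
    show "el (int m) False \<notin> ?H" 
      unfolding mem using m_pos by (simp add: m zdvd_not_zless)
    show "el (int n) False \<in> ?H" unfolding mem using assms(1) by simp
    show "el (int m) False \<otimes> el (int m) False \<in> ?H" unfolding el_mult mem by (simp add: m)
  qed (simp_all add: H)
qed

section \<open>Subgroups that are perfect codes\<close>

lemma el_mult_y: "el a False \<otimes> y = el a True"
  by (simp add: el_def)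

lemma inv_el_mult_el: "inv (el a b) \<otimes> el c b = el (if b then a - c else c - a) False"
  by (simp add: inv_el el_mult el_eq_iff)

lemma inv_el_mult_el_neq: "b \<noteq> d \<Longrightarrow> \<exists>e. inv (el a b) \<otimes> el c d = el e True"
  by (cases b) (auto simp: inv_el el_mult)

text \<open>Write \<open>t = 2 * h\<close>; an odd quotient makes \<open>n\<close> congruent to
  \<open>h\<close> modulo \<open>t\<close>. The powers of \<open>x\<close> in \<open>S\<close> then
  have each nonzero residue exactly once, the residue \<open>h\<close> coming from
  \<open>x^n\<close>; the elements with \<open>y\<close> have the residues
  \<open>0, ..., h - 1\<close> and, shifted by \<open>n\<close>,
  \<open>h, ..., t - 1\<close>.\<close>

lemma cyclic_perfect_code:
  assumes t: "t > 0" "t dvd 2 * n" "odd (2 * n div t)"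
  defines "S \<equiv> {x [^] n} \<union>
      {x [^] i | i :: nat. 1 \<le> i \<and> i \<le> t div 2 - 1} \<union>
      {inv (x [^] i) | i :: nat. 1 \<le> i \<and> i \<le> t div 2 - 1} \<union>
      {x [^] i \<otimes> y | i :: nat. i \<le> t div 2 - 1} \<union>
      {x [^] (n + i) \<otimes> y | i :: nat. i \<le> t div 2 - 1}"
  shows "connection_set G S" "perfect_code (cayley_graph G S) (generate G {x [^] t})"
proof -
  let ?H = "generate G {x [^] t}"
  have H: "subgroup ?H G" by (rule generate_is_subgroup) auto
  note mem = el_in_generate_cyclic[OF t(2)]
  obtain m where m: "2 * n = t * m" using t(2) by blast
  have "odd m" using t(1,3) m by simp
  then have "even t" using m by (metis dvd_triv_left even_mult_iff)
  then obtain h where h: "t = 2 * h" by blast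
  obtain q where q: "m = 2 * q + 1" using \<open>odd m\<close> by (rule oddE)
  have h_pos: "h > 0" using t(1) h by simp
  have "n = 2 * h * q + h" using m by (simp add: h q)
  then have n: "int n = int t * int q + int h" and hn: "h \<le> n" by (simp_all add: h)
  \<comment> \<open>Integer exponents of the elements of \<open>S\<close>, by type; the two
    intervals for type \<open>True\<close> are disjoint as \<open>h \<le> n\<close>.\<close>
  define P :: "int \<Rightarrow> bool \<Rightarrow> bool" where
    "P = (\<lambda>a b. if b then (0 \<le> a \<and> a < int h) \<or> (int n \<le> a \<and> a < int n + int h)
       else a = int n \<or> (a \<noteq> 0 \<and> \<bar>a\<bar> < int h))"
  have S: "S = {el a b | a b. P a b}" (is "_ = ?S")
  proof
    \<comment> \<open>Here \<open>h > 0\<close> ensures that the natural subtraction does not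
      truncate.\<close>
    have "i \<le> t div 2 - 1 \<longleftrightarrow> i < h" for i using h_pos by (auto simp: h)
    then have S': "S = {el (int n) False} \<union> {el (int i) False | i. 1 \<le> i \<and> i < h} \<union>
        {el (- int i) False | i. 1 \<le> i \<and> i < h} \<union> {el (int i) True | i. i < h} \<union>
        {el (int (n + i)) True | i. i < h}"
      by (simp only: S_def power_eq_el inv_el el_mult_y if_False)
    show "S \<subseteq> ?S"
    proof
      fix g assume "g \<in> S"
      then consider "g = el (int n) False"
        | i where "1 \<le> i" "i < h" "g = el (int i) False"
        | i where "1 \<le> i" "i < h" "g = el (- int i) False"
        | i where "i < h" "g = el (int i) True"
        | i where "i < h" "g = el (int (n + i)) True"
        unfolding S' by blast
      moreover have "P (int n) False" "1 \<le> i \<Longrightarrow> i < h \<Longrightarrow> P (int i) False"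
        "1 \<le> i \<Longrightarrow> i < h \<Longrightarrow> P (- int i) False" "i < h \<Longrightarrow> P (int i) True"
        "i < h \<Longrightarrow> P (int (n + i)) True" for i
        by (simp_all add: P_def)
      ultimately show "g \<in> ?S" by cases blast+
    qed
    show "?S \<subseteq> S"
    proof
      fix g assume "g \<in> ?S"
      then obtain a b where g: "g = el a b" "P a b" by blast
      define i where "i = (if b \<and> a \<ge> int h then nat (a - int n) else nat \<bar>a\<bar>)"
      have "b \<and> i < h \<and> (a = int i \<or> a = int (n + i))
          \<or> \<not> b \<and> (a = int n \<or> 1 \<le> i \<and> i < h \<and> (a = int i \<or> a = - int i))"
        using g(2) by (auto simp: P_def i_def split: if_splits)
      then show "g \<in> S" unfolding S' g(1) by (cases b) (simp, blast)+
    qed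
  qed
  have small: "z = 0" if "int t dvd z" "\<bar>z\<bar> < int t" for z
    using that dvd_imp_le_int[of z "int t"] by auto
  have disjoint: "S \<inter> ?H = {}"
  proof -
    have "el a b \<notin> ?H" if P: "P a b" for a b
    proof
      assume "el a b \<in> ?H"
      then have b: "\<not> b" and a: "int t dvd a" by (simp_all add: mem)
      show False
      proof (cases "a = int n")
        case True
        then have "int t dvd int h" using a n by (simp add: dvd_add_right_iff)
        then show False using small[of "int h"] h h_pos by simp
      next
        case False
        then show False using P b small[OF a] h by (simp add: P_def)
      qed
    qed
    then show ?thesis unfolding S by blast
  qed
  have SG: "S \<subseteq> carrier G" unfolding S by auto
  show "connection_set G S"
    unfolding connection_set_def
  proof (intro conjI ballI SG)
    show "\<one> \<notin> S" using disjoint subgroup.one_closed[OF H] by blast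
    fix g assume "g \<in> S"
    then obtain a b where g: "g = el a b" "P a b" unfolding S by blast
    \<comment> \<open>The exponent of the inverse, brought back into the range of \<open>P\<close>:
      the inverse of \<open>x^a y\<close> is \<open>x^(a + n) y = x^(a - n) y\<close>, so the two
      intervals are swapped, while \<open>x^n\<close> is its own inverse.\<close>
    define c where "c = (if b then (if a < int h then a + int n else a - int n)
      else if a = int n then a else - a)"
    have "P c b" using g(2) hn by (cases b) (auto simp: P_def c_def)
    moreover have "inv g = el c b" by (auto simp: g(1) inv_el el_eq_iff c_def)
    ultimately show "inv g \<in> S" unfolding S by blast
  qed
  show "perfect_code (cayley_graph G S) ?H"
  proof (rule perfect_code_cayley_graphI[OF H SG disjoint])
    fix v assume v: "v \<in> carrier G" "v \<notin> ?H"
    then obtain c d where cd: "v = el c d" using carrierE by metis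
    define r where "r = c mod int t"
    define e where "e = c div int t"
    have c: "c = int t * e + r" by (simp add: r_def e_def)
    have r: "0 \<le> r" "r < int t" using t(1) by (simp_all add: r_def)
    have "\<exists>a. P a d \<and> int t dvd c - a"
    \<comment> \<open>For \<open>r < h\<close> the representative is \<open>r\<close> itself.
      Otherwise it is \<open>n + r - h\<close> for elements with \<open>y\<close> and for
      \<open>r = h\<close>, and the negative \<open>r - t\<close> for the other powers of
      \<open>x\<close>.\<close>
    proof (cases "r < int h")
      case True
      have "r \<noteq> 0" if "\<not> d" using v(2) that by (auto simp: cd mem c)
      then have "P r d" using True r by (auto simp: P_def)
      moreover have "int t dvd c - r" by (simp add: c)
      ultimately show ?thesis by blast
    next
      case False
      have n': "c - (int n + r - int h) = int t * (e - int q)"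
        by (simp add: c n algebra_simps)
      show ?thesis
      proof (cases "d \<or> r = int h")
        case True
        then have "P (int n + r - int h) d" using False r h by (auto simp: P_def)
        then show ?thesis using n' by (metis dvd_triv_left)
      next
        case False': False
        have "c - (r - int t) = int t * (e + 1)" by (simp add: c algebra_simps)
        moreover have "P (r - int t) d" using False False' r h by (auto simp: P_def)
        ultimately show ?thesis by (metis dvd_triv_left)
      qed
    qed
    then obtain a where a: "P a d" "int t dvd c - a" by blast
    then have "int t dvd a - c" by (simp only: dvd_diff_commute)
    then have "inv (el a d) \<otimes> v \<in> ?H" using a(2) by (simp add: cd inv_el_mult_el mem)
    then show "\<exists>s\<in>S. inv s \<otimes> v \<in> ?H" using a(1) unfolding S by blast
  next
    fix s s' assume s: "s \<in> S" "s' \<in> S" "inv s \<otimes> s' \<in> ?H"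
    obtain a b where ab: "s = el a b" "P a b" using s(1) unfolding S by blast
    obtain c d where cd: "s' = el c d" "P c d" using s(2) unfolding S by blast
    have bd: "b = d"
    proof (rule ccontr)
      assume "b \<noteq> d"
      from inv_el_mult_el_neq[OF this, of a c] show False using s(3) by (auto simp: ab(1) cd(1) mem)
    qed
    have "int t dvd (if b then a - c else c - a)"
      using s(3) by (simp only: ab(1) cd(1) bd inv_el_mult_el mem)
    then have ac: "int t dvd a - c" by (cases b) (simp_all add: dvd_diff_commute)
    \<comment> \<open>The bounds \<open>n - h = t q\<close> and \<open>n + h = t (q + 1)\<close> are
      consecutive multiples of \<open>t\<close>. This handles a pair of exponents of which only one
      belongs to the part of \<open>S\<close> shifted by \<open>n\<close>.\<close>
    have far: False if "int t dvd z" "int n - int h < z" "z < int n + int h" for z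
    proof -
      have "int t dvd int n - int h" by (simp add: n)
      from dvd_diff[OF that(1) this] have "z - (int n - int h) = 0"
        using that(2,3) h by (intro small) auto
      then show False using that(2) by simp
    qed
    have ca: "int t dvd c - a" using ac by (simp only: dvd_diff_commute)
    have "\<bar>a - c\<bar> < int t \<or> int n - int h < a - c \<and> a - c < int n + int h
        \<or> int n - int h < c - a \<and> c - a < int n + int h"
      using ab(2) cd(2) bd h h_pos by (cases b) (auto simp: P_def)
    then have "a = c" using small[OF ac] far[OF ac] far[OF ca] by (elim disjE conjE) simp_all
    then show "s = s'" by (simp add: ab(1) cd(1) bd)
  qed
qed

text \<open>With \<open>t = 2 * h + 1\<close>, the nonzero integers from \<open>-h\<close> to
  \<open>h\<close> represent each nonzero residue modulo \<open>t\<close> once, and the left cosets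
  of \<open>H\<close> are represented by the powers of \<open>x\<close> modulo
  \<open>t\<close>.\<close>

lemma dicyclic_perfect_code:
  fixes s :: nat
  assumes t: "t \<ge> 3" "odd t" "t dvd n"
  defines "S \<equiv> {x [^] i | i :: nat. 1 \<le> i \<and> i \<le> (t - 1) div 2} \<union>
      {inv (x [^] i) | i :: nat. 1 \<le> i \<and> i \<le> (t - 1) div 2}"
  shows "connection_set G S" "perfect_code (cayley_graph G S) (generate G {x [^] t, x [^] s \<otimes> y})"
proof -
  let ?H = "generate G {x [^] t, x [^] s \<otimes> y}"
  have H: "subgroup ?H G" by (rule generate_is_subgroup) auto
  note mem = el_in_generate_dicyclic[OF t(3)]
  obtain h where h: "t = 2 * h + 1" using t(2) by (rule oddE)
  have S: "S = {el a False | a. a \<noteq> 0 \<and> \<bar>a\<bar> \<le> int h}" (is "_ = ?S")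
  proof
    show "S \<subseteq> ?S" unfolding S_def power_eq_el inv_el by (force simp: h)
    show "?S \<subseteq> S"
    proof
      fix g assume "g \<in> ?S"
      then obtain a where g: "g = el a False" "a \<noteq> 0" "\<bar>a\<bar> \<le> int h" by blast
      define i where "i = nat \<bar>a\<bar>"
      have "1 \<le> i \<and> i \<le> (t - 1) div 2 \<and> (a = int i \<or> a = - int i)"
        using g(2,3) by (auto simp: i_def h)
      then show "g \<in> S" unfolding S_def power_eq_el inv_el using g(1) by auto
    qed
  qed
  have small: "z = 0" if "int t dvd z" "\<bar>z\<bar> < int t" for z
    using that dvd_imp_le_int[of z "int t"] by auto
  have disjoint: "S \<inter> ?H = {}"
  proof -
    have "el a False \<notin> ?H" if "a \<noteq> 0" "\<bar>a\<bar> \<le> int h" for a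
      unfolding mem using that small[of a] h by auto
    then show ?thesis unfolding S by blast
  qed
  have SG: "S \<subseteq> carrier G" unfolding S by auto
  show "connection_set G S"
    unfolding connection_set_def
  proof (intro conjI ballI SG)
    show "\<one> \<notin> S" using disjoint subgroup.one_closed[OF H] by blast
    fix g assume "g \<in> S"
    then obtain a where g: "g = el a False" "a \<noteq> 0" "\<bar>a\<bar> \<le> int h" unfolding S by blast
    have "inv g = el (- a) False" "- a \<noteq> 0" "\<bar>- a\<bar> \<le> int h" using g by (simp_all add: inv_el)
    then show "inv g \<in> S" unfolding S by blast
  qed
  show "perfect_code (cayley_graph G S) ?H"
  proof (rule perfect_code_cayley_graphI[OF H SG disjoint])
    fix v assume v: "v \<in> carrier G" "v \<notin> ?H"
    then obtain c d where cd: "v = el c d" using carrierE by metis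
    \<comment> \<open>Since \<open>x^s y\<close> lies in \<open>H\<close>, splitting it off on the
      right leaves \<open>x^c'\<close> as a representative of the coset of \<open>v\<close>.\<close>
    define c' where "c' = c - (if d then int s else 0)"
    define r where "r = c' mod int t"
    have r: "0 \<le> r" "r < int t" using t(1) by (simp_all add: r_def)
    have "int t dvd c' - r" by (simp add: r_def)
    moreover have "r \<noteq> 0" using v(2) by (auto simp: cd mem r_def c'_def)
    \<comment> \<open>The remainder is moved from \<open>[0, t)\<close> to the symmetric range from
      \<open>-h\<close> to \<open>h\<close>.\<close>
    moreover define a where "a = (if r \<le> int h then r else r - int t)"
    ultimately have a: "a \<noteq> 0" "\<bar>a\<bar> \<le> int h" "int t dvd c' - a"
      using r dvd_add[of "int t" "c' - r" "int t"] by (auto simp: h algebra_simps)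
    have "inv (el a False) \<otimes> v = el (c - a) d" by (simp add: cd inv_el el_mult)
    also have "\<dots> \<in> ?H" using a(3) by (simp add: mem c'_def algebra_simps)
    finally show "\<exists>s\<in>S. inv s \<otimes> v \<in> ?H" using a(1,2) unfolding S by blast
  next
    fix g g' assume g: "g \<in> S" "g' \<in> S" "inv g \<otimes> g' \<in> ?H"
    obtain a where a: "g = el a False" "\<bar>a\<bar> \<le> int h" using g(1) unfolding S by blast
    obtain c where c: "g' = el c False" "\<bar>c\<bar> \<le> int h" using g(2) unfolding S by blast
    have "int t dvd c - a" using g(3) by (simp add: a(1) c(1) inv_el_mult_el mem)
    then have "c - a = 0" using a(2) c(2) h by (intro small) auto
    then show "g = g'" by (simp add: a(1) c(1))
  qed
qed

text \<open>For \<open>t = 1\<close> the divisibility condition for membership is void; properness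
  of \<open>H\<close> therefore rules out this odd value.\<close>

lemma generate_eq_carrier:
  fixes s :: nat
  shows "generate G {x [^] (1::nat), x [^] s \<otimes> y} = carrier G"
proof (rule subset_eqI)
  show "generate G {x [^] (1::nat), x [^] s \<otimes> y} \<subseteq> carrier G" by (rule generate_incl) auto
  show "el a b \<in> generate G {x [^] (1::nat), x [^] s \<otimes> y} \<longleftrightarrow> el a b \<in> carrier G" for a b
    using el_in_generate_dicyclic[of 1 a b s] by simp
qed simp

end

section \<open>Classification of the subgroup perfect codes of \<open>Q_{4n}\<close>\<close>

theorem theorem1p7:
  fixes n :: nat and H :: "quat_gen word set set"
  assumes "n \<ge> 2"
    and "subgroup H (Quat n)"
    and "H \<noteq> carrier (Quat n)"
  shows "(group_perfect_code (Quat n) H \<longleftrightarrow>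
      (\<exists>t::nat. t > 0 \<and> t dvd 2 * n \<and> odd (2 * n div t) \<and>
         H = generate (Quat n) {quat_x n [^]\<^bsub>Quat n\<^esub> t}) \<or>
      (\<exists>t s::nat. t \<ge> 3 \<and> odd t \<and> t dvd 2 * n \<and> s \<le> t - 1 \<and>
         H = generate (Quat n)
           {quat_x n [^]\<^bsub>Quat n\<^esub> t, quat_x n [^]\<^bsub>Quat n\<^esub> s \<otimes>\<^bsub>Quat n\<^esub> quat_y n})) \<and>
    (\<forall>t::nat. t > 0 \<and> t dvd 2 * n \<and> odd (2 * n div t) \<and>
       H = generate (Quat n) {quat_x n [^]\<^bsub>Quat n\<^esub> t} \<longrightarrow>
         connection_set (Quat n) (quat_conn_a n t) \<and>
         perfect_code (cayley_graph (Quat n) (quat_conn_a n t)) H) \<and>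
    (\<forall>t s::nat. t \<ge> 3 \<and> odd t \<and> t dvd 2 * n \<and> s \<le> t - 1 \<and>
       H = generate (Quat n)
         {quat_x n [^]\<^bsub>Quat n\<^esub> t, quat_x n [^]\<^bsub>Quat n\<^esub> s \<otimes>\<^bsub>Quat n\<^esub> quat_y n} \<longrightarrow>
         connection_set (Quat n) (quat_conn_b n t) \<and>
         perfect_code (cayley_graph (Quat n) (quat_conn_b n t)) H)"
    (is "(?code \<longleftrightarrow> ?cyclic \<or> ?dicyclic) \<and> ?conn_a \<and> ?conn_b")
proof -
  interpret generalized_quaternion "Quat n" n "quat_x n" "quat_y n"
    using assms(1) by (intro generalized_quaternion_Quat) simp
  have conn_a: ?conn_a
    unfolding quat_conn_a_def Let_def using cyclic_perfect_code by blast
  \<comment> \<open>An odd \<open>t\<close> is coprime to 2; this turns the divisibility in case (b)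
    into the one that the description of the subgroup requires.\<close>
  have "t dvd n" if "odd t" "t dvd 2 * n" for t :: nat
    using that by (simp add: coprime_dvd_mult_right_iff)
  then have conn_b: ?conn_b
    unfolding quat_conn_b_def Let_def using dicyclic_perfect_code by blast
  have "?cyclic \<or> ?dicyclic" if code: ?code
    using assms(2)
  proof (cases rule: subgroup_cases)
    case (cyclic t)
    have "odd (2 * n div t)"
    proof
      assume "even (2 * n div t)"
      \<comment> \<open>An even quotient lets the factor 2 cancel, so \<open>t\<close> divides
        \<open>n\<close> and \<open>x^n\<close> would lie in \<open>H\<close>.\<close>
      then obtain k where "2 * n = t * (2 * k)" using cyclic(2) by (metis dvd_mult_div_cancel evenE)
      then have "t dvd n" by simp
      then show False using not_group_perfect_code_cyclic code cyclic(3) by blast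
    qed
    then show ?thesis using cyclic by blast
  next
    case (dicyclic t s)
    have "odd t" using not_group_perfect_code_dicyclic dicyclic(2,4) code by blast
    moreover have "t \<noteq> 1" using generate_eq_carrier assms(3) dicyclic(4) by blast
    ultimately have "t \<ge> 3" by presburger
    moreover have "t dvd 2 * n" "s \<le> t - 1" using dicyclic(2,3) by simp_all
    ultimately show ?thesis using \<open>odd t\<close> dicyclic(4) by blast
  qed
  moreover have ?code if "?cyclic \<or> ?dicyclic"
    using that conn_a conn_b unfolding group_perfect_code_def by blast
  ultimately show ?thesis using conn_a conn_b by blast
qed

end
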